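(* Let $G$ be an infinite compact Hausdorff topological group. Then there is a subset of $G$ with the strong Baire property that is strongly generic but not uniformly strongly generic.
   Context: $A\subseteq G$ has the strong Baire property if $\mathrm{int}(A)\cup\mathrm{int}(G\setminus A)$ is dense. $B\subseteq G$ is ($m$-)generic if $G$ is a union of ($m$) finitely many left translates of $B$. $A$ is strongly generic if every non-empty set in the smallest family containing $A$ closed under finite unions, complements and left translations is generic. $A$ is uniformly strongly generic if for each Boolean term $\tau(X_1,\dots,X_n)$ there is $m_\tau$ such that for all $g_i\in G$, $\tau(g_1A,\dots,g_nA)$ is empty or $m_\tau$-generic. *)

theory Defs
  imports "HOL-Analysis.Analysis"
begin

text \<open>
  Topological groups are taken from the type class \<open>topological_group_add\<close>. It extends
  \<open>group_add\<close>, so despite the additive notation the group need not be abelian, and the order of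
  summands matters: the left translate \<open>gB\<close> is \<open>(+) g ` B\<close>.
\<close>

definition strong_Baire_property :: "'a::topological_space set \<Rightarrow> bool" where
  "strong_Baire_property A \<longleftrightarrow> closure (interior A \<union> interior (- A)) = UNIV"

text \<open>The \<open>m\<close> translates need not be distinct.\<close>

definition m_generic :: "nat \<Rightarrow> 'a::group_add set \<Rightarrow> bool" where
  "m_generic m B \<longleftrightarrow> (\<exists>g :: nat \<Rightarrow> 'a. (\<Union>i<m. (+) (g i) ` B) = UNIV)"

definition generic :: "'a::group_add set \<Rightarrow> bool" where
  "generic B \<longleftrightarrow> (\<exists>m. m_generic m B)"

text \<open>
  The empty union needs no rule of its own: \<open>{}\<close> is the complement of \<open>A \<union> - A\<close>.
\<close>

inductive_set translation_algebra :: "'a::group_add set \<Rightarrow> 'a set set"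
  for A :: "'a set" where
  base: "A \<in> translation_algebra A"
| union: "B \<in> translation_algebra A \<Longrightarrow> C \<in> translation_algebra A \<Longrightarrow> B \<union> C \<in> translation_algebra A"
| compl: "B \<in> translation_algebra A \<Longrightarrow> - B \<in> translation_algebra A"
| translate: "B \<in> translation_algebra A \<Longrightarrow> (+) g ` B \<in> translation_algebra A"

definition strongly_generic :: "'a::group_add set \<Rightarrow> bool" where
  "strongly_generic A \<longleftrightarrow> (\<forall>B \<in> translation_algebra A. B \<noteq> {} \<longrightarrow> generic B)"

datatype bool_term =
    Var nat
  | Bot
  | Top
  | Compl bool_term
  | Join bool_term bool_term
  | Meet bool_term bool_term

primrec eval_term :: "(nat \<Rightarrow> 'a set) \<Rightarrow> bool_term \<Rightarrow> 'a set" where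
  "eval_term X (Var i) = X i"
| "eval_term X Bot = {}"
| "eval_term X Top = UNIV"
| "eval_term X (Compl t) = - eval_term X t"
| "eval_term X (Join s t) = eval_term X s \<union> eval_term X t"
| "eval_term X (Meet s t) = eval_term X s \<inter> eval_term X t"

text \<open>
  The translating elements are given as an infinite sequence \<open>g\<close>; only the finitely many entries
  whose index occurs in \<open>\<tau>\<close> affect the value.
\<close>

definition uniformly_strongly_generic :: "'a::group_add set \<Rightarrow> bool" where
  "uniformly_strongly_generic A \<longleftrightarrow>
    (\<forall>\<tau>. \<exists>m. \<forall>g :: nat \<Rightarrow> 'a.
       eval_term (\<lambda>i. (+) (g i) ` A) \<tau> = {} \<or> m_generic m (eval_term (\<lambda>i. (+) (g i) ` A) \<tau>))"

end

theory Submission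
  imports Defs
begin

text \<open>
  For an ultrafilter \<open>p\<close> that converges to \<open>0\<close> and contains all dense open sets, the map
  \<open>S \<mapsto> {x. - x + S \<in> p}\<close> commutes with the Boolean operations and with left translations. It sends
  each set with the strong Baire property to a superset of its interior, and to the empty set if
  that interior is empty; a non-empty open set is generic by compactness. So the image of an open
  set is strongly generic, just as a half-open arc of the circle is.

  If the image \<open>A\<close> of an open set \<open>O\<close> is not clopen, then \<open>A - (g + A)\<close> is non-empty for
  arbitrarily small \<open>g\<close>, while its \<open>m\<close> translates cannot cover \<open>G\<close> when \<open>g\<close> is close to \<open>0\<close>, as
  the frontier of \<open>A\<close> is nowhere dense. If \<open>A\<close> is clopen, then it is the closure of \<open>O\<close>. It remains
  to find an open set whose closure is not open, i.e. to see that an infinite compact group is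
  not extremally disconnected.
\<close>

section \<open>Ultrafilters\<close>

text \<open>By Zorn there is a minimal proper filter \<open>p\<close> below \<open>F\<close>. It
  decides every \<open>P\<close>: otherwise its infimum with the principal filter of
  \<open>P\<close> would be proper and strictly smaller.\<close>

lemma ex_ultrafilter_le:
  fixes F :: "'a filter"
  assumes "F \<noteq> bot"
  obtains p where "p \<le> F" "p \<noteq> bot"
    "\<And>P. (\<forall>\<^sub>F x in p. \<not> P x) \<longleftrightarrow> \<not> (\<forall>\<^sub>F x in p. P x)"
proof -
  let ?A = "{G. G \<noteq> bot \<and> G \<le> F}"
  have "\<exists>p\<in>?A. \<forall>G\<in>?A. p \<ge> G \<longrightarrow> G = p"
  proof (rule predicate_Zorn)
    show "partial_order_on ?A (relation_of (\<ge>) ?A)"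
      by (rule partial_order_on_relation_ofI) auto
    fix C assume C: "C \<in> Chains (relation_of (\<ge>) ?A)"
    show "\<exists>u\<in>?A. \<forall>a\<in>C. u \<le> a"
    proof (cases "C = {}")
      case True
      then show ?thesis using assms by auto
    next
      case False
      have CA: "C \<subseteq> ?A"
        using C unfolding Chains_def relation_of_def by auto
      \<comment> \<open>A non-empty chain is directed, so whatever holds eventually in
        \<open>Inf C\<close> already does so in a member of \<open>C\<close>; hence
        \<open>Inf C\<close> stays proper.\<close>
      have "eventually P (Inf C) \<longleftrightarrow> (\<exists>b\<in>C. eventually P b)" for P
      proof (rule eventually_Inf_base[OF False])
        fix G H assume "G \<in> C" "H \<in> C"
        then have "G \<le> H \<or> H \<le> G"
          using C unfolding Chains_def relation_of_def by blast
        then show "\<exists>x\<in>C. x \<le> inf G H"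
          using \<open>G \<in> C\<close> \<open>H \<in> C\<close> by (metis inf.absorb1 inf.absorb2 order.refl)
      qed
      then have "Inf C \<noteq> bot"
        using CA unfolding trivial_limit_def by auto
      moreover obtain c where "c \<in> C" "c \<le> F"
        using False CA by blast
      then have "Inf C \<le> F"
        by (rule Inf_lower2)
      ultimately show ?thesis
        by (auto intro: Inf_lower)
    qed
  qed
  then obtain p where p: "p \<noteq> bot" "p \<le> F"
    and max: "\<And>G. G \<noteq> bot \<Longrightarrow> G \<le> F \<Longrightarrow> G \<le> p \<Longrightarrow> G = p"
    by auto
  have "(\<forall>\<^sub>F x in p. \<not> P x) \<longleftrightarrow> \<not> (\<forall>\<^sub>F x in p. P x)" for P
  proof
    assume "\<forall>\<^sub>F x in p. \<not> P x"
    then show "\<not> (\<forall>\<^sub>F x in p. P x)"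
      using p(1) eventually_elim2[of _ p _ "\<lambda>_. False"] unfolding trivial_limit_def by blast
  next
    assume not: "\<not> (\<forall>\<^sub>F x in p. P x)"
    show "\<forall>\<^sub>F x in p. \<not> P x"
    proof (rule ccontr)
      let ?G = "inf p (principal {x. P x})"
      assume "\<not> (\<forall>\<^sub>F x in p. \<not> P x)"
      then have "?G \<noteq> bot"
        by (simp add: trivial_limit_def eventually_inf_principal)
      then have "?G = p"
        using p(2) by (intro max) (auto intro: le_infI1)
      moreover have "eventually P ?G"
        by (simp add: eventually_inf_principal)
      ultimately show False using not by simp
    qed
  qed
  with p show thesis using that by blast
qed

section \<open>Open sets in topological groups\<close>

lemma mem_left_translate_iff: "x \<in> (+) g ` S \<longleftrightarrow> - g + x \<in> S" for g :: "'a::group_add"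
  by (metis (no_types, lifting) add_minus_cancel image_iff minus_add_cancel)

lemma open_left_translate:
  fixes g :: "'a::topological_group_add"
  assumes "open S"
  shows "open ((+) g ` S)"
proof -
  have "(+) g ` S = (\<lambda>x. - g + x) -` S"
    by (auto simp: mem_left_translate_iff)
  then show ?thesis
    using assms by (auto intro!: open_vimage continuous_intros)
qed

lemma open_vimage_diff:
  fixes y :: "'a::topological_group_add"
  assumes "open S"
  shows "open ((\<lambda>x. x - y) -` S)" "open ((\<lambda>x. y - x) -` S)"
  unfolding diff_conv_add_uminus using assms by (intro open_vimage continuous_intros; assumption)+

lemma generic_if_open_subset:
  fixes B :: "'a::topological_group_add set"
  assumes "compact (UNIV :: 'a set)" "open W" "W \<noteq> {}" "W \<subseteq> B"
  shows "generic B"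
proof -
  obtain w where "w \<in> W" using assms(3) by auto
  have "x \<in> (+) (x - w) ` W" for x
    using \<open>w \<in> W\<close> by (auto simp: image_iff intro!: bexI[of _ w])
  then have "UNIV \<subseteq> (\<Union>g\<in>UNIV. (+) g ` W)" by blast
  with compactE_image[OF assms(1), of UNIV "\<lambda>g. (+) g ` W"]
  obtain C where C: "finite C" "UNIV \<subseteq> (\<Union>g\<in>C. (+) g ` W)"
    using open_left_translate[OF assms(2)] by metis
  then obtain m and f :: "nat \<Rightarrow> 'a" where "C = f ` {i. i < m}"
    unfolding finite_conv_nat_seg_image by blast
  then have "UNIV \<subseteq> (\<Union>i<m. (+) (f i) ` W)"
    using C(2) by (simp add: lessThan_def)
  also have "\<dots> \<subseteq> (\<Union>i<m. (+) (f i) ` B)"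
    by (intro UN_mono image_mono assms(4) order.refl)
  finally have "(\<Union>i<m. (+) (f i) ` B) = UNIV"
    by blast
  then show ?thesis unfolding generic_def m_generic_def by blast
qed

section \<open>Density and the algebra of sets with the strong Baire property\<close>

lemma mem_closure_iff: "x \<in> closure S \<longleftrightarrow> (\<forall>G. open G \<longrightarrow> x \<in> G \<longrightarrow> G \<inter> S \<noteq> {})"
proof -
  have "x \<in> interior (- S) \<longleftrightarrow> (\<exists>G. open G \<and> x \<in> G \<and> G \<subseteq> - S)"
    unfolding interior_def by blast
  then show ?thesis
    unfolding interior_closure by auto
qed

lemma dense_iff: "closure D = UNIV \<longleftrightarrow> (\<forall>W. open W \<longrightarrow> W \<noteq> {} \<longrightarrow> W \<inter> D \<noteq> {})"
  unfolding set_eq_iff[of "closure D"] mem_closure_iff by auto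

text \<open>This local form can be iterated: for a union, an open set is shrunk first to decide
  \<open>S\<close> and then to decide \<open>T\<close>.\<close>

lemma strong_Baire_property_iff:
  fixes S :: "'a::topological_space set"
  shows "strong_Baire_property S \<longleftrightarrow>
    (\<forall>W. open W \<longrightarrow> W \<noteq> {} \<longrightarrow> (\<exists>W'\<subseteq>W. open W' \<and> W' \<noteq> {} \<and> (W' \<subseteq> S \<or> W' \<subseteq> - S)))"
  (is "_ \<longleftrightarrow> ?R")
proof
  assume S: "strong_Baire_property S"
  show ?R
  proof (intro allI impI)
    fix W :: "'a set" assume W: "open W" "W \<noteq> {}"
    then have "W \<inter> (interior S \<union> interior (- S)) \<noteq> {}"
      using S unfolding strong_Baire_property_def dense_iff by blast
    then consider "W \<inter> interior S \<noteq> {}" | "W \<inter> interior (- S) \<noteq> {}" by auto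
    then show "\<exists>W'\<subseteq>W. open W' \<and> W' \<noteq> {} \<and> (W' \<subseteq> S \<or> W' \<subseteq> - S)"
    proof cases
      case 1
      then show ?thesis using W(1) interior_subset[of S]
        by (intro exI[of _ "W \<inter> interior S"]) auto
    next
      case 2
      then show ?thesis using W(1) interior_subset[of "- S"]
        by (intro exI[of _ "W \<inter> interior (- S)"]) auto
    qed
  qed
next
  assume R: ?R
  let ?I = "interior S \<union> interior (- S)"
  have "- closure ?I = {}"
  proof (rule ccontr)
    assume "- closure ?I \<noteq> {}"
    then obtain W' where W': "W' \<subseteq> - closure ?I" "open W'" "W' \<noteq> {}" "W' \<subseteq> S \<or> W' \<subseteq> - S"
      using R open_Compl[OF closed_closure] by meson
    then have "W' \<subseteq> ?I" using interior_maximal by blast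
    then show False using W'(1,3) closure_subset[of ?I] by blast
  qed
  then show "strong_Baire_property S"
    unfolding strong_Baire_property_def by blast
qed

lemma strong_Baire_property_open:
  fixes S :: "'a::topological_space set"
  assumes "open S"
  shows "strong_Baire_property S"
  unfolding strong_Baire_property_iff
proof (intro allI impI)
  fix W :: "'a set" assume "open W" "W \<noteq> {}"
  show "\<exists>W'\<subseteq>W. open W' \<and> W' \<noteq> {} \<and> (W' \<subseteq> S \<or> W' \<subseteq> - S)"
  proof (cases "W \<inter> S = {}")
    case True
    with \<open>open W\<close> \<open>W \<noteq> {}\<close> show ?thesis
      by (intro exI[of _ W] conjI disjI2) auto
  next
    case False
    with \<open>open W\<close> assms show ?thesis
      by (intro exI[of _ "W \<inter> S"] conjI disjI1 open_Int) auto
  qed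
qed

lemma strong_Baire_property_Compl: "strong_Baire_property S \<Longrightarrow> strong_Baire_property (- S)"
  by (simp add: strong_Baire_property_def Un_commute)

lemma strong_Baire_property_Un:
  fixes S :: "'a::topological_space set"
  assumes "strong_Baire_property S" "strong_Baire_property T"
  shows "strong_Baire_property (S \<union> T)"
  unfolding strong_Baire_property_iff
proof (intro allI impI)
  fix W :: "'a set" assume "open W" "W \<noteq> {}"
  then obtain W' where W': "W' \<subseteq> W" "open W'" "W' \<noteq> {}" "W' \<subseteq> S \<or> W' \<subseteq> - S"
    using assms(1) unfolding strong_Baire_property_iff by meson
  then obtain W'' where W'': "W'' \<subseteq> W'" "open W''" "W'' \<noteq> {}" "W'' \<subseteq> T \<or> W'' \<subseteq> - T"
    using assms(2) unfolding strong_Baire_property_iff by meson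
  have "W'' \<subseteq> S \<union> T \<or> W'' \<subseteq> - (S \<union> T)"
    using W'(4) W''(1,4) by blast
  with W' W'' show "\<exists>W'\<subseteq>W. open W' \<and> W' \<noteq> {} \<and> (W' \<subseteq> S \<union> T \<or> W' \<subseteq> - (S \<union> T))"
    by (metis order.trans)
qed

lemma strong_Baire_property_left_translate:
  fixes g :: "'a::topological_group_add"
  assumes "strong_Baire_property S"
  shows "strong_Baire_property ((+) g ` S)"
  unfolding strong_Baire_property_iff
proof (intro allI impI)
  fix W :: "'a set" assume W: "open W" "W \<noteq> {}"
  then have "open ((+) (- g) ` W)" "(+) (- g) ` W \<noteq> {}"
    by (auto intro: open_left_translate)
  then obtain W' where W': "W' \<subseteq> (+) (- g) ` W" "open W'" "W' \<noteq> {}" "W' \<subseteq> S \<or> W' \<subseteq> - S"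
    using assms unfolding strong_Baire_property_iff by meson
  have "(+) g ` W' \<subseteq> W"
    using image_mono[OF W'(1), of "(+) g"] by (simp add: image_image)
  moreover have "(+) g ` W' \<subseteq> (+) g ` S \<or> (+) g ` W' \<subseteq> - (+) g ` S"
    using W'(4) by (auto simp: mem_left_translate_iff)
  ultimately show "\<exists>W'\<subseteq>W. open W' \<and> W' \<noteq> {} \<and> (W' \<subseteq> (+) g ` S \<or> W' \<subseteq> - (+) g ` S)"
    using open_left_translate[OF W'(2)] W'(3) by (metis image_is_empty)
qed

section \<open>Ultrafilter limits of translates\<close>

text \<open>The proper filters below this one are those that converge to \<open>0\<close> and
  contain all dense open sets.\<close>

definition dense_open_nhds :: "'a::{topological_space, zero} filter" where
  "dense_open_nhds =
    (INF S\<in>{U \<inter> D | U D. open U \<and> 0 \<in> U \<and> open D \<and> closure D = UNIV}. principal S)"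

lemma eventually_dense_open_nhds:
  "eventually P (dense_open_nhds :: 'a::{topological_space, zero} filter) \<longleftrightarrow>
    (\<exists>U D. open U \<and> 0 \<in> U \<and> open D \<and> closure D = UNIV \<and> (\<forall>x\<in>U \<inter> D. P x))"
proof -
  let ?B = "{U \<inter> D | U D. open U \<and> (0::'a) \<in> U \<and> open D \<and> closure D = UNIV}"
  have "eventually P dense_open_nhds \<longleftrightarrow> (\<exists>S\<in>?B. eventually P (principal S))"
    unfolding dense_open_nhds_def
  proof (rule eventually_INF_base)
    show "?B \<noteq> {}"
      by (auto intro!: exI[of _ UNIV])
  next
    fix a b assume "a \<in> ?B" "b \<in> ?B"
    then obtain U D U' D' where a: "a = U \<inter> D" "open U" "0 \<in> U" "open D" "closure D = UNIV"
      and b: "b = U' \<inter> D'" "open U'" "0 \<in> U'" "open D'" "closure D' = UNIV" by auto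
    \<comment> \<open>A non-empty open set meets \<open>D\<close> in a non-empty open set, which
      \<open>D'\<close> meets in turn.\<close>
    have "closure (D \<inter> D') = UNIV"
      using a(4,5) b(4,5) unfolding dense_iff by (metis Int_assoc open_Int)
    then have "(U \<inter> U') \<inter> (D \<inter> D') \<in> ?B"
      using a b by (intro CollectI exI[of _ "U \<inter> U'"] exI[of _ "D \<inter> D'"]) auto
    then show "\<exists>x\<in>?B. principal x \<le> inf (principal a) (principal b)"
      by (rule bexI[rotated]) (auto simp: a b)
  qed
  also have "\<dots> \<longleftrightarrow> (\<exists>U D. open U \<and> 0 \<in> U \<and> open D \<and> closure D = UNIV \<and> (\<forall>x\<in>U \<inter> D. P x))"
    unfolding eventually_principal by auto
  finally show ?thesis .
qed

lemma dense_open_nhds_neq_bot: "dense_open_nhds \<noteq> bot"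
proof -
  have "U \<inter> D \<noteq> {}" if "open U" "0 \<in> U" "closure D = UNIV" for U D :: "'a set"
    using that unfolding dense_iff by blast
  then show ?thesis
    unfolding trivial_limit_def eventually_dense_open_nhds by blast
qed

text \<open>This is \<open>{x. - x + S \<in> p}\<close>. The limit is taken on the right, which is
  why it commutes with left translations.\<close>

definition right_limit_set :: "'a::plus filter \<Rightarrow> 'a set \<Rightarrow> 'a set" where
  "right_limit_set p S = {x. \<forall>\<^sub>F t in p. x + t \<in> S}"

locale dense_ultrafilter =
  fixes p :: "'a::topological_group_add filter"
  assumes le: "p \<le> dense_open_nhds"
    and not_eventually_iff: "(\<forall>\<^sub>F x in p. \<not> P x) \<longleftrightarrow> \<not> (\<forall>\<^sub>F x in p. P x)"
begin

lemma limit_Compl: "right_limit_set p (- S) = - right_limit_set p S"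
  by (auto simp: right_limit_set_def not_eventually_iff)

text \<open>Every filter respects finite intersections; complements carry this over to
  unions.\<close>

lemma limit_Un: "right_limit_set p (S \<union> T) = right_limit_set p S \<union> right_limit_set p T"
proof -
  have "x \<in> right_limit_set p (- S) \<inter> right_limit_set p (- T) \<longleftrightarrow> x \<in> right_limit_set p (- (S \<union> T))" for x
    by (simp add: right_limit_set_def eventually_conj_iff)
  then show ?thesis unfolding limit_Compl by blast
qed

lemma limit_left_translate: "right_limit_set p ((+) g ` S) = (+) g ` right_limit_set p S"
  by (auto simp: right_limit_set_def mem_left_translate_iff add.assoc)

text \<open>For \<open>x\<close> in \<open>W\<close>, the translate \<open>- x + W\<close> is an
  open neighbourhood of \<open>0\<close>, hence a member of \<open>p\<close>.\<close>

lemma open_subset_limit: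
  assumes "open W" "W \<subseteq> S"
  shows "W \<subseteq> right_limit_set p S"
proof
  fix x assume "x \<in> W"
  then have "open ((+) (- x) ` W)" "0 \<in> (+) (- x) ` W"
    using assms(1) by (auto simp: open_left_translate mem_left_translate_iff)
  moreover have "x + t \<in> S" if "t \<in> (+) (- x) ` W" for t
    using that assms(2) by (auto simp: mem_left_translate_iff)
  ultimately have "\<forall>\<^sub>F t in dense_open_nhds. x + t \<in> S"
    unfolding eventually_dense_open_nhds
    by (intro exI[of _ "(+) (- x) ` W"] exI[of _ UNIV]) auto
  then show "x \<in> right_limit_set p S"
    using le unfolding right_limit_set_def le_filter_def by blast
qed

text \<open>Here \<open>interior (- S)\<close> is dense, so all its left translates are dense open
  sets and belong to \<open>p\<close>. Thus every point lies in the limit of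
  \<open>- S\<close>.\<close>

lemma limit_empty_interior:
  assumes "strong_Baire_property S" "interior S = {}"
  shows "right_limit_set p S = {}"
proof -
  have "x \<in> right_limit_set p (- S)" for x
  proof -
    let ?D = "(+) (- x) ` interior (- S)"
    have "W \<inter> ?D \<noteq> {}" if W: "open W" "W \<noteq> {}" for W
    proof -
      obtain W' where W': "W' \<subseteq> (+) x ` W" "open W'" "W' \<noteq> {}" "W' \<subseteq> S \<or> W' \<subseteq> - S"
        using assms(1) W open_left_translate[of W x] unfolding strong_Baire_property_iff
        by (metis image_is_empty)
      then have "W' \<subseteq> interior (- S)"
        using assms(2) interior_maximal by blast
      then have "(+) (- x) ` W' \<subseteq> W \<inter> ?D"
        using image_mono[OF W'(1), of "(+) (- x)"] by (auto simp: image_image)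
      then show ?thesis using W' by blast
    qed
    then have "closure ?D = UNIV"
      unfolding dense_iff by blast
    moreover have "x + t \<in> - S" if "t \<in> ?D" for t
      using that interior_subset[of "- S"] by (auto simp: mem_left_translate_iff)
    ultimately have "\<forall>\<^sub>F t in dense_open_nhds. x + t \<in> - S"
      unfolding eventually_dense_open_nhds
      by (intro exI[of _ UNIV] exI[of _ ?D]) (auto simp: open_left_translate)
    then show ?thesis
      using le unfolding right_limit_set_def le_filter_def by blast
  qed
  then show ?thesis unfolding limit_Compl by blast
qed

lemma strong_Baire_property_limit:
  assumes "strong_Baire_property S"
  shows "strong_Baire_property (right_limit_set p S)"
  unfolding strong_Baire_property_iff
proof (intro allI impI)
  fix W :: "'a set" assume "open W" "W \<noteq> {}"
  then obtain W' where W': "W' \<subseteq> W" "open W'" "W' \<noteq> {}" "W' \<subseteq> S \<or> W' \<subseteq> - S"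
    using assms unfolding strong_Baire_property_iff by meson
  then have "W' \<subseteq> right_limit_set p S \<or> W' \<subseteq> - right_limit_set p S"
    using open_subset_limit limit_Compl by metis
  with W' show "\<exists>W'\<subseteq>W. open W' \<and> W' \<noteq> {} \<and>
      (W' \<subseteq> right_limit_set p S \<or> W' \<subseteq> - right_limit_set p S)"
    by blast
qed

lemma limit_subset_closure: "right_limit_set p S \<subseteq> closure S"
  using open_subset_limit[of "- closure S" "- S"] closure_subset[of S] unfolding limit_Compl
  by auto

lemma translation_algebra_limit:
  assumes "strong_Baire_property S" "B \<in> translation_algebra (right_limit_set p S)"
  shows "\<exists>T. strong_Baire_property T \<and> B = right_limit_set p T"
  using assms(2)
proof induction
  case base
  then show ?case using assms(1) by blast
next
  case (union B C)
  then show ?case by (metis limit_Un strong_Baire_property_Un)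
next
  case (compl B)
  then show ?case by (metis limit_Compl strong_Baire_property_Compl)
next
  case (translate B g)
  then show ?case by (metis limit_left_translate strong_Baire_property_left_translate)
qed

lemma strongly_generic_limit:
  assumes "compact (UNIV :: 'a set)" "strong_Baire_property S"
  shows "strongly_generic (right_limit_set p S)"
  unfolding strongly_generic_def
proof (intro ballI impI)
  fix B assume "B \<in> translation_algebra (right_limit_set p S)" "B \<noteq> {}"
  then obtain T where "strong_Baire_property T" "B = right_limit_set p T" "right_limit_set p T \<noteq> {}"
    using translation_algebra_limit[OF assms(2)] by blast
  \<comment> \<open>\<open>interior T\<close> is non-empty, as otherwise \<open>B\<close> would be
    empty, and it is contained in \<open>B\<close>.\<close>
  then show "generic B"
    using generic_if_open_subset[OF assms(1), of "interior T"] limit_empty_interior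
      open_subset_limit[of "interior T" T] interior_subset[of T] by blast
qed

end

section \<open>Failure of uniformity\<close>

text \<open>Induction on \<open>m\<close>: for \<open>h\<close> near a given element and \<open>g\<close> near \<open>0\<close>, the translate of
  \<open>A - (g + A)\<close> by \<open>h\<close> misses a fixed non-empty open subset of \<open>W\<close>. By compactness, finitely many
  such subsets serve for all \<open>h\<close>, and the remaining translates do not cover any of them.\<close>

lemma small_difference_not_covering:
  fixes A W :: "'a::topological_group_add set"
  assumes "compact (UNIV :: 'a set)" "strong_Baire_property A" "open W" "W \<noteq> {}"
  shows "\<exists>U. open U \<and> 0 \<in> U \<and>
    (\<forall>g\<in>U. \<forall>h :: nat \<Rightarrow> 'a. \<not> W \<subseteq> (\<Union>i<m. (+) (h i) ` (A - (+) g ` A)))"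
  using assms(3,4)
proof (induction m arbitrary: W)
  case 0
  then show ?case by (intro exI[of _ UNIV]) auto
next
  case (Suc m)
  have "\<exists>K Q U. open K \<and> h \<in> K \<and> open Q \<and> Q \<noteq> {} \<and> Q \<subseteq> W \<and> open U \<and> 0 \<in> U \<and>
    (\<forall>k\<in>K. \<forall>g\<in>U. Q \<inter> (+) k ` (A - (+) g ` A) = {})" for h
  proof -
    have "open ((+) (- h) ` W)" "(+) (- h) ` W \<noteq> {}"
      using Suc.prems by (auto simp: open_left_translate)
    then obtain W' where W': "W' \<subseteq> (+) (- h) ` W" "open W'" "W' \<noteq> {}" "W' \<subseteq> A \<or> W' \<subseteq> - A"
      using assms(2) unfolding strong_Baire_property_iff by meson
    then obtain y where "y \<in> W'" by blast
    \<comment> \<open>On \<open>?X\<close> both \<open>- k + q\<close> and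
      \<open>- g + (- k + q)\<close> lie in \<open>W'\<close>, where membership in \<open>A\<close>
      is constant; so \<open>- k + q\<close> is not in \<open>A - (g + A)\<close>.\<close>
    let ?X = "(\<lambda>(k, q, g). - g + (- k + q)) -` W' \<inter> (\<lambda>(k, q, g::'a). - k + q) -` W'"
    have X: "open ?X"
      using W'(2) by (auto intro!: open_Int open_vimage continuous_intros simp: case_prod_beta)
    have "(h, h + y, 0) \<in> ?X"
      using \<open>y \<in> W'\<close> by simp
    then obtain K R where K: "open K" "open R" "(h, h + y, 0) \<in> K \<times> R" "K \<times> R \<subseteq> ?X"
      by (rule open_prod_elim[OF X])
    then have "(h + y, 0) \<in> R" by simp
    then obtain Q U where Q: "open Q" "open U" "(h + y, 0) \<in> Q \<times> U" "Q \<times> U \<subseteq> R"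
      by (rule open_prod_elim[OF K(2)])
    have "q \<notin> (+) k ` (A - (+) g ` A)" if "k \<in> K" "q \<in> Q" "g \<in> U" for k q g
    proof -
      have "(q, g) \<in> R" using Q(4) that by blast
      then have "(k, q, g) \<in> ?X" using K(4) that by blast
      then show ?thesis
        using W'(4) by (auto simp: mem_left_translate_iff)
    qed
    moreover have "h + y \<in> W"
      using W'(1) \<open>y \<in> W'\<close> by (auto simp: subset_iff mem_left_translate_iff)
    ultimately show ?thesis
      using K(1,3) Q(1-3) Suc.prems(1)
      by (intro exI[of _ K] exI[of _ "Q \<inter> W"] exI[of _ U]) auto
  qed
  then obtain K Q U where KQU: "\<And>h. open (K h)" "\<And>h. h \<in> K h" "\<And>h. open (Q h)" "\<And>h. Q h \<noteq> {}"
    "\<And>h. Q h \<subseteq> W" "\<And>h. open (U h)" "\<And>h. 0 \<in> U h"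
    "\<And>h k g. k \<in> K h \<Longrightarrow> g \<in> U h \<Longrightarrow> Q h \<inter> (+) k ` (A - (+) g ` A) = {}"
    by metis
  have "\<exists>V. open V \<and> 0 \<in> V \<and>
      (\<forall>g\<in>V. \<forall>f :: nat \<Rightarrow> 'a. \<not> Q h \<subseteq> (\<Union>i<m. (+) (f i) ` (A - (+) g ` A)))" for h
    using Suc.IH[OF KQU(3,4)] .
  then obtain V where V: "\<And>h. open (V h)" "\<And>h. 0 \<in> V h"
    "\<And>h g f. g \<in> V h \<Longrightarrow> \<not> Q h \<subseteq> (\<Union>i<m. (+) (f i) ` (A - (+) g ` A))"
    by metis
  have "UNIV \<subseteq> (\<Union>h\<in>UNIV. K h)" using KQU(2) by blast
  then obtain C where C: "finite C" "UNIV \<subseteq> (\<Union>h\<in>C. K h)"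
    using compactE_image[OF assms(1), of UNIV K] KQU(1) by metis
  \<comment> \<open>\<open>U h\<close> disposes of the last translate on \<open>Q h\<close>, and
    \<open>V h\<close> of the other \<open>m\<close> translates.\<close>
  let ?U = "\<Inter>h\<in>C. U h \<inter> V h"
  have "\<not> W \<subseteq> (\<Union>i<Suc m. (+) (f i) ` (A - (+) g ` A))" if g: "g \<in> ?U" for g and f :: "nat \<Rightarrow> 'a"
  proof
    assume cover: "W \<subseteq> (\<Union>i<Suc m. (+) (f i) ` (A - (+) g ` A))"
    obtain h where h: "h \<in> C" "f m \<in> K h" using C(2) by blast
    have g': "g \<in> U h" "g \<in> V h" using g h(1) by auto
    have "W \<subseteq> (+) (f m) ` (A - (+) g ` A) \<union> (\<Union>i<m. (+) (f i) ` (A - (+) g ` A))"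
      using cover by (simp add: lessThan_Suc)
    then have "Q h \<subseteq> (\<Union>i<m. (+) (f i) ` (A - (+) g ` A))"
      using KQU(5)[of h] KQU(8)[OF h(2) g'(1)] by blast
    then show False using V(3)[OF g'(2)] by blast
  qed
  moreover have "open ?U" "0 \<in> ?U"
    using C(1) KQU(6,7) V(1,2) by (auto intro!: open_INT open_Int)
  ultimately show ?case by blast
qed

text \<open>If \<open>x\<close> is in \<open>A\<close> and \<open>x - y\<close> in \<open>U\<close>,
  then \<open>y = - (x - y) + x\<close> is in \<open>A\<close>. Fixing \<open>x\<close> and varying
  \<open>y\<close> gives openness; fixing \<open>y\<close> and varying \<open>x\<close> gives
  closedness.\<close>

lemma clopen_if_left_invariant:
  fixes A :: "'a::topological_group_add set"
  assumes U: "open U" "0 \<in> U" "\<And>g. g \<in> U \<Longrightarrow> A \<subseteq> (+) g ` A"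
  shows "open A" "closed A"
proof -
  have inv: "- g + x \<in> A" if "g \<in> U" "x \<in> A" for g x
    using U(3) that mem_left_translate_iff by blast
  have "open ((\<lambda>y. x - y) -` U)" for x
    using U(1) by (rule open_vimage_diff)
  moreover have "y \<in> A" if "x \<in> A" "x - y \<in> U" for x y
    using inv[OF that(2,1)] by (simp add: minus_diff_eq)
  ultimately show "open A"
    using U(2) unfolding open_subopen[of A]
    by (metis (no_types, lifting) diff_self subsetI vimageI vimageE)
  have "y \<in> A" if "y \<in> closure A" for y
  proof -
    have "(\<lambda>x. x - y) -` U \<inter> A \<noteq> {}"
      using that U(2) open_vimage_diff(1)[OF U(1), of y] by (simp add: mem_closure_iff)
    then obtain x where "x \<in> A" "x - y \<in> U"
      by blast
    then show ?thesis
      using inv[of "x - y" x] by (simp add: minus_diff_eq)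
  qed
  then show "closed A"
    by (metis closure_subset closure_eq subsetI subset_antisym)
qed

lemma not_uniformly_strongly_generic:
  fixes A :: "'a::topological_group_add set"
  assumes "compact (UNIV :: 'a set)" "strong_Baire_property A" "\<not> (open A \<and> closed A)"
  shows "\<not> uniformly_strongly_generic A"
proof
  \<comment> \<open>Translating \<open>Var 0\<close> by \<open>0\<close> and \<open>Var 1\<close> by
    \<open>g\<close> makes this term \<open>A - (g + A)\<close>.\<close>
  let ?\<tau> = "Meet (Var 0) (Compl (Var 1))"
  assume "uniformly_strongly_generic A"
  then obtain m where m: "\<And>g :: nat \<Rightarrow> 'a. eval_term (\<lambda>i. (+) (g i) ` A) ?\<tau> = {} \<or>
      m_generic m (eval_term (\<lambda>i. (+) (g i) ` A) ?\<tau>)"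
    unfolding uniformly_strongly_generic_def by meson
  obtain U where U: "open U" "0 \<in> U"
    "\<And>g h. g \<in> U \<Longrightarrow> \<not> UNIV \<subseteq> (\<Union>i<m. (+) (h i :: 'a) ` (A - (+) g ` A))"
    using small_difference_not_covering[OF assms(1,2) open_UNIV UNIV_not_empty] by metis
  have "A \<subseteq> (+) g ` A" if "g \<in> U" for g
  proof -
    have eval: "eval_term (\<lambda>i. (+) ((\<lambda>i. if i = 0 then 0 else g) i) ` A) ?\<tau> = A - (+) g ` A"
      by auto
    have "A - (+) g ` A = {} \<or> m_generic m (A - (+) g ` A)"
      using m[of "\<lambda>i. if i = 0 then 0 else g"] unfolding eval .
    then show ?thesis
      using U(3)[OF that] unfolding m_generic_def by blast
  qed
  with U(1,2) clopen_if_left_invariant assms(3) show False by blast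
qed

section \<open>Infinite compact groups are not extremally disconnected\<close>

lemma ex_small_symmetric_nhd:
  fixes V :: "'a::{topological_group_add, t2_space} set"
  assumes "compact (UNIV :: 'a set)" "infinite (UNIV :: 'a set)" "open V" "0 \<in> V"
  shows "\<exists>W. open W \<and> 0 \<in> W \<and> (\<forall>a\<in>W. - a \<in> W) \<and> (\<forall>a\<in>W. \<forall>b\<in>W. a + b \<in> V) \<and>
    (\<exists>x\<in>V. (+) x ` W \<subseteq> V - W)"
proof -
  \<comment> \<open>Some point is a limit point; translating it to \<open>0\<close> yields a
    non-zero \<open>x\<close> in \<open>V\<close>.\<close>
  obtain z :: 'a where "z islimpt UNIV"
    using Heine_Borel_imp_Bolzano_Weierstrass[OF assms(1,2)] by auto
  moreover have "open ((+) z ` V)" "z \<in> (+) z ` V"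
    using assms(3,4) by (auto simp: open_left_translate mem_left_translate_iff)
  ultimately obtain y where y: "y \<in> (+) z ` V" "y \<noteq> z"
    unfolding islimpt_def by blast
  define x where "x = - z + y"
  have x: "x \<in> V" "x \<noteq> 0"
    using y by (auto simp: x_def mem_left_translate_iff neg_eq_iff_add_eq_0[symmetric])
  then obtain P Q where PQ: "open P" "open Q" "x \<in> P" "0 \<in> Q" "P \<inter> Q = {}"
    using hausdorff by metis
  have "open ((\<lambda>(a, b). a + b) -` V)" "(0, 0) \<in> (\<lambda>(a, b). a + b) -` V"
    using assms(3,4) by (auto intro!: open_vimage continuous_intros simp: case_prod_beta)
  then obtain R S where RS: "open R" "0 \<in> R" "open S" "0 \<in> S" "R \<times> S \<subseteq> (\<lambda>(a, b). a + b) -` V"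
    by (rule open_prod_elim) auto
  \<comment> \<open>\<open>R\<close> and \<open>S\<close> put sums of two elements of
    \<open>W\<close> into \<open>V\<close>; \<open>x + W\<close> lies in \<open>P\<close> and
    \<open>W\<close> in \<open>Q\<close>, so they are disjoint.\<close>
  define T where "T = R \<inter> S \<inter> Q \<inter> (\<lambda>w. x + w) -` (P \<inter> V)"
  define W where "W = T \<inter> uminus -` T"
  have T: "open T" "0 \<in> T"
    unfolding T_def using PQ RS x assms(3) by (auto intro!: open_Int open_vimage continuous_intros)
  have "open W"
    unfolding W_def using T by (auto intro!: open_Int open_vimage continuous_intros)
  moreover have "0 \<in> W" "\<forall>a\<in>W. - a \<in> W" "\<forall>a\<in>W. \<forall>b\<in>W. a + b \<in> V"
    using T RS(5) by (auto simp: W_def T_def)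
  moreover have "(+) x ` W \<subseteq> V - W"
    using PQ(5) by (auto simp: W_def T_def)
  ultimately show ?thesis using x(1) by blast
qed

text \<open>With \<open>H = (\<Inter>n. V n)\<close>, the open sets \<open>x n + V (n + 1)\<close> are pairwise disjoint and contain the
  cosets \<open>x n + H\<close>. As \<open>x n\<close> converges to \<open>0\<close> modulo \<open>H\<close>, any infinite union of them has \<open>0\<close> in its
  closure. The unions over even and over odd \<open>n\<close> are disjoint, so neither closure can be open.\<close>

lemma ex_open_closure_not_open:
  assumes "compact (UNIV :: 'a::{topological_group_add, t2_space} set)" "infinite (UNIV :: 'a set)"
  shows "\<exists>S :: 'a set. open S \<and> \<not> open (closure S)"
proof -
  let ?Q = "\<lambda>V W :: 'a set. (\<forall>a\<in>W. - a \<in> W) \<and> (\<forall>a\<in>W. \<forall>b\<in>W. a + b \<in> V) \<and>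
    (\<exists>x\<in>V. (+) x ` W \<subseteq> V - W)"
  have "\<exists>V. \<forall>n. (open (V n) \<and> 0 \<in> V n) \<and> ?Q (V n) (V (Suc n))"
  proof (rule dependent_nat_choice)
    show "\<exists>V :: 'a set. open V \<and> 0 \<in> V" by blast
    show "\<exists>W. (open W \<and> 0 \<in> W) \<and> ?Q V W" if "open V \<and> 0 \<in> V" for V :: "'a set" and n :: nat
      using ex_small_symmetric_nhd[OF assms, of V] that by blast
  qed
  then obtain V where "\<forall>n. (open (V n) \<and> 0 \<in> V n) \<and> ?Q (V n) (V (Suc n))"
    by (rule exE)
  then have V: "\<And>n. open (V n) \<and> 0 \<in> V n" "\<And>n. ?Q (V n) (V (Suc n))"
    by simp_all
  then have "\<forall>n. \<exists>x. x \<in> V n \<and> (+) x ` V (Suc n) \<subseteq> V n - V (Suc n)"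
    by blast
  then obtain x where x: "\<And>n. x n \<in> V n" "\<And>n. (+) (x n) ` V (Suc n) \<subseteq> V n - V (Suc n)"
    by metis
  define S where "S n = (+) (x n) ` V (Suc n)" for n
  have openS: "open (S n)" for n
    using V(1) by (auto simp: S_def open_left_translate)
  have "V (Suc n) \<subseteq> V n" for n
    using V(1)[of "Suc n"] V(2)[of n] by (metis add.right_neutral subsetI)
  then have decV: "V n \<subseteq> V m" if "m \<le> n" for m n
    using that by (rule lift_Suc_antimono_le)
  \<comment> \<open>\<open>S m\<close> avoids \<open>V (Suc m)\<close>, which contains
    \<open>V n\<close> and hence \<open>S n\<close>.\<close>
  have disjS: "S m \<inter> S n = {}" if "m < n" for m n
    using x(2)[of m] x(2)[of n] decV[of "Suc m" n] that by (auto simp: S_def)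
  \<comment> \<open>If \<open>z\<close> lies in both \<open>V (Suc n)\<close> and
    \<open>y + V (Suc n)\<close>, then \<open>y = z + - (- y + z)\<close> lies in \<open>V n\<close>
    by symmetry.\<close>
  have clV: "closure (V (Suc n)) \<subseteq> V n" for n
  proof
    fix y assume y: "y \<in> closure (V (Suc n))"
    have "open ((+) y ` V (Suc n))" "y \<in> (+) y ` V (Suc n)"
      using V(1) by (auto simp: open_left_translate mem_left_translate_iff)
    then obtain z where "z \<in> V (Suc n)" "- y + z \<in> V (Suc n)"
      using y open_Int_closure_eq_empty[of "(+) y ` V (Suc n)" "V (Suc n)"]
      by (force simp: mem_left_translate_iff)
    then have "z + - (- y + z) \<in> V n"
      using V(2)[of n] by blast
    then show "y \<in> V n"
      by (simp add: minus_add add.assoc[symmetric])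
  qed
  define H where "H = (\<Inter>n. V n)"
  \<comment> \<open>A point outside \<open>H\<close> is outside some
    \<open>closure (V (Suc n))\<close>, so compactness leaves finitely many indices, and the
    \<open>V n\<close> decrease.\<close>
  have V_small: "\<exists>n. V n \<subseteq> G" if G: "open G" "H \<subseteq> G" for G
  proof -
    have "UNIV \<subseteq> (\<Union>n. G \<union> - closure (V (Suc n)))"
    proof
      fix y
      show "y \<in> (\<Union>n. G \<union> - closure (V (Suc n)))"
      proof (cases "y \<in> H")
        case False
        then obtain n where "y \<notin> V n" by (auto simp: H_def)
        then show ?thesis using clV[of n] by blast
      qed (use G(2) in blast)
    qed
    moreover have "open (G \<union> - closure (V (Suc n)))" for n
      using G(1) by (intro open_Un open_Compl closed_closure)
    ultimately obtain I where I: "finite I" "UNIV \<subseteq> (\<Union>n\<in>I. G \<union> - closure (V (Suc n)))"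
      using compactE_image[OF assms(1), of UNIV "\<lambda>n. G \<union> - closure (V (Suc n))"] by metis
    obtain k where k: "\<And>n. n \<in> I \<Longrightarrow> n \<le> k"
      using I(1) finite_nat_set_iff_bounded_le by metis
    have "V (Suc k) \<subseteq> G"
    proof
      fix y assume "y \<in> V (Suc k)"
      then have "y \<in> closure (V (Suc n))" if "n \<in> I" for n
        using k[OF that] decV[of "Suc n" "Suc k"] closure_subset by blast
      then show "y \<in> G" using I(2) by blast
    qed
    then show ?thesis by blast
  qed
  have cl: "0 \<in> closure (\<Union>n\<in>J. S n)" if J: "infinite J" for J
  proof -
    have "G \<inter> (\<Union>n\<in>J. S n) \<noteq> {}" if G: "open G" "0 \<in> G" for G
    proof -
      \<comment> \<open>This union is \<open>G + H\<close>, an open set around \<open>H\<close>; it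
        contains \<open>x k\<close> for all large \<open>k\<close>.\<close>
      have "open (\<Union>h\<in>H. (\<lambda>y. y - h) -` G)"
        using G(1) by (intro open_UN ballI open_vimage_diff)
      moreover have "H \<subseteq> (\<Union>h\<in>H. (\<lambda>y. y - h) -` G)"
        using G(2) by auto
      ultimately obtain n where n: "V n \<subseteq> (\<Union>h\<in>H. (\<lambda>y. y - h) -` G)"
        using V_small by blast
      obtain k where k: "k \<in> J" "n \<le> k"
        using J infinite_nat_iff_unbounded_le by blast
      then obtain h where h: "h \<in> H" "x k - h \<in> G"
        using n x(1)[of k] decV[of n k] by blast
      then have "- h \<in> V (Suc k)"
        using V(2)[of k] by (auto simp: H_def)
      then have "x k - h \<in> S k"
        by (simp add: S_def mem_left_translate_iff diff_conv_add_uminus del: add_uminus_conv_diff)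
      then show ?thesis using h k by blast
    qed
    then show ?thesis
      unfolding mem_closure_iff by blast
  qed
  let ?E = "\<Union>n\<in>{n. even n}. S n" and ?O = "\<Union>n\<in>{n. odd n}. S n"
  have "\<exists>n\<ge>m. n \<in> {n. even n}" for m :: nat
    by (rule exI[of _ "2 * m"]) simp
  then have "infinite {n :: nat. even n}"
    unfolding infinite_nat_iff_unbounded_le ..
  then have E: "0 \<in> closure ?E"
    by (rule cl)
  have "\<exists>n\<ge>m. n \<in> {n. odd n}" for m :: nat
    by (rule exI[of _ "2 * m + 1"]) simp
  then have "infinite {n :: nat. odd n}"
    unfolding infinite_nat_iff_unbounded_le ..
  then have O: "0 \<in> closure ?O"
    by (rule cl)
  have disj: "?O \<inter> ?E = {}"
  proof -
    have "S m \<inter> S n = {}" if "even m" "odd n" for m n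
      using disjS[of m n] disjS[of n m] that by (metis inf_commute linorder_neqE_nat)
    then show ?thesis by blast
  qed
  have opens: "open ?E" "open ?O"
    using openS by auto
  \<comment> \<open>If open, \<open>closure ?E\<close> is a neighbourhood of \<open>0\<close> and so
    meets \<open>?O\<close>; but the open set \<open>?O\<close>, being disjoint from
    \<open>?E\<close>, misses its closure.\<close>
  have "closure ?E \<inter> ?O \<noteq> {}" if "open (closure ?E)"
    using O E that unfolding mem_closure_iff[of 0 ?O] by blast
  moreover have "?O \<inter> closure ?E = {}"
    using disj opens(2) by (simp only: open_Int_closure_eq_empty)
  ultimately have "\<not> open (closure ?E)"
    by (metis Int_commute)
  with opens(1) show ?thesis by blast
qed

theorem theorem4p25:
  assumes "compact (UNIV :: 'a::{topological_group_add, t2_space} set)"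
    and "infinite (UNIV :: 'a set)"
  shows "\<exists>A :: 'a set. strong_Baire_property A \<and> strongly_generic A \<and> \<not> uniformly_strongly_generic A"
proof -
  obtain p :: "'a filter" where "dense_ultrafilter p"
    using ex_ultrafilter_le[OF dense_open_nhds_neq_bot] unfolding dense_ultrafilter_def by metis
  then interpret dense_ultrafilter p .
  obtain S :: "'a set" where S: "open S" "\<not> open (closure S)"
    using ex_open_closure_not_open[OF assms] by blast
  let ?A = "right_limit_set p S"
  have S': "strong_Baire_property S"
    using S(1) by (rule strong_Baire_property_open)
  \<comment> \<open>A closed set between \<open>S\<close> and \<open>closure S\<close> equals
    \<open>closure S\<close>, which is not open.\<close>
  have "\<not> (open ?A \<and> closed ?A)"
    using S open_subset_limit[OF S(1) order.refl] limit_subset_closure[of S]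
    by (metis closure_minimal subset_antisym)
  with assms(1) S' show ?thesis
    by (meson not_uniformly_strongly_generic strong_Baire_property_limit strongly_generic_limit)
qed

end
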